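(* Let $L\subset L^0$ be a vector space of $\mathbb{R}$-valued random variables on $([0,1],\mathscr{B},\lambda)$ (the standard probability space with its Borel sets and Lebesgue measure) such that $L\supsetneqq L^1$ and $|Y|\in L$ whenever $Y\in L$. Then there does not exist a version independent, finite valued risk measure on $L$.
   Context: $L^0$ is the space of all real-valued random variables on $([0,1],\mathscr{B},\lambda)$, identified when almost surely equal, and $L^1$ the integrable ones. A finite valued risk measure on $L$ is a function $\rho:L\to\mathbb{R}$ satisfying: (Monotonicity) $\rho(Y_1)\le\rho(Y_2)$ whenever $Y_1\le Y_2$ almost surely; (Positive homogeneity) $\rho(\lambda Y)=\lambda\rho(Y)$ whenever $\lambda>0$; (Convexity) $\rho((1-\lambda)Y_0+\lambda Y_1)\le(1-\lambda)\rho(Y_0)+\lambda\rho(Y_1)$ for $0\le\lambda\le1$; (Translation equivariance) $\rho(Y+c)=\rho(Y)+c$ for $c\in\mathbb{R}$. It is version independent (law invariant) if $\rho(Y)=\rho(Y')$ whenever $Y,Y'\in L$ have the same law. *)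

theory Defs
  imports "HOL-Probability.Probability"
begin

definition unit_interval :: "real measure" where
  "unit_interval = restrict_space lborel {0..1}"

text \<open>
  A set of elements of \<open>L\<^sup>0\<close> (random variables modulo almost sure equality) is represented by
  the set of all representatives of its members, i.e. by a set of measurable functions that is
  closed under almost sure equality. Linear subspaces of \<open>L\<^sup>0\<close> thus correspond one-to-one to
  the sets satisfying the following predicate. (The values of the functions outside \<open>space M\<close>
  are unconstrained, since neither measurability nor almost sure equality depends on them.)
\<close>

definition L0_subspace :: "'a measure \<Rightarrow> ('a \<Rightarrow> real) set \<Rightarrow> bool" where
  "L0_subspace M L \<longleftrightarrow>
     L \<subseteq> borel_measurable M \<and>
     (\<forall>Y\<in>L. \<forall>Y'\<in>borel_measurable M. (AE \<omega> in M. Y \<omega> = Y' \<omega>) \<longrightarrow> Y' \<in> L) \<and>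
     (\<lambda>\<omega>. 0) \<in> L \<and>
     (\<forall>Y\<in>L. \<forall>Z\<in>L. (\<lambda>\<omega>. Y \<omega> + Z \<omega>) \<in> L) \<and>
     (\<forall>a. \<forall>Y\<in>L. (\<lambda>\<omega>. a * Y \<omega>) \<in> L)"

definition L1 :: "'a measure \<Rightarrow> ('a \<Rightarrow> real) set" where
  "L1 M = {Y. integrable M Y}"

text \<open>
  Only the values of \<open>\<rho>\<close> on \<open>L\<close> matter. That \<open>\<rho>\<close> is well defined on classes modulo almost sure
  equality is not a separate requirement: it follows from monotonicity.
\<close>

definition risk_measure :: "'a measure \<Rightarrow> ('a \<Rightarrow> real) set \<Rightarrow> (('a \<Rightarrow> real) \<Rightarrow> real) \<Rightarrow> bool" where
  "risk_measure M L \<rho> \<longleftrightarrow>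
     (\<forall>Y\<^sub>1\<in>L. \<forall>Y\<^sub>2\<in>L. (AE \<omega> in M. Y\<^sub>1 \<omega> \<le> Y\<^sub>2 \<omega>) \<longrightarrow> \<rho> Y\<^sub>1 \<le> \<rho> Y\<^sub>2) \<and>
     (\<forall>Y\<in>L. \<forall>a>0. \<rho> (\<lambda>\<omega>. a * Y \<omega>) = a * \<rho> Y) \<and>
     (\<forall>Y\<^sub>0\<in>L. \<forall>Y\<^sub>1\<in>L. \<forall>a. 0 \<le> a \<and> a \<le> 1 \<longrightarrow>
        \<rho> (\<lambda>\<omega>. (1 - a) * Y\<^sub>0 \<omega> + a * Y\<^sub>1 \<omega>) \<le> (1 - a) * \<rho> Y\<^sub>0 + a * \<rho> Y\<^sub>1) \<and>
     (\<forall>Y\<in>L. \<forall>c. \<rho> (\<lambda>\<omega>. Y \<omega> + c) = \<rho> Y + c)"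

definition version_independent ::
  "'a measure \<Rightarrow> ('a \<Rightarrow> real) set \<Rightarrow> (('a \<Rightarrow> real) \<Rightarrow> real) \<Rightarrow> bool" where
  "version_independent M L \<rho> \<longleftrightarrow>
     (\<forall>Y\<in>L. \<forall>Y'\<in>L. distr M borel Y = distr M borel Y' \<longrightarrow> \<rho> Y = \<rho> Y')"

end

theory Submission
  imports Defs
begin

text \<open>
  The reason is that a version independent risk measure \<open>\<rho>\<close> dominates the expectation, so that on
  a nonnegative \<open>X\<close> of infinite expectation it would have to be infinite. Since \<open>L\<close> is strictly
  larger than \<open>L\<^sup>1\<close> and closed under absolute values, it contains such an \<open>X\<close>.

  The domination comes from averaging over versions. By positive homogeneity and convexity \<open>\<rho>\<close> is
  subadditive, and \<open>\<rho> c = c\<close> for constants. If \<open>Q\<^sub>0, \<dots>, Q\<^sub>N\<^sub>-\<^sub>1\<close> are versions of \<open>S\<close>, then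
  \<open>\<rho> (Q\<^sub>0 + \<dots> + Q\<^sub>N\<^sub>-\<^sub>1) \<le> N * \<rho> S\<close>. When the \<open>Q\<^sub>j\<close> are the rotations by \<open>j / N\<close> of one function on
  the circle, their sum is nearly the constant \<open>N * E S\<close>, which gives \<open>E S \<le> \<rho> S\<close> as \<open>N\<close> grows.

  Almost constancy must hold uniformly, because monotonicity of \<open>\<rho>\<close> uses almost sure inequalities.
  Therefore \<open>X\<close> is first replaced by the minorant \<open>S\<close> that counts the levels \<open>1, \<dots>, n\<close> reached
  by \<open>X\<close>. It is a sum of \<open>n\<close> indicators of decreasing events, and its law depends only on the
  probabilities of these events (lemma \<open>distr_sum_indicator_decseq_eq\<close>). So the events may be
  exchanged for the intervals \<open>[0, a\<^sub>k)\<close>, with \<open>a\<^sub>k\<close> the probability that \<open>X\<close> is at least \<open>k + 1\<close>,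
  and for rotations of these intervals (lemma \<open>measure_rotated_interval\<close>). Of \<open>N\<close> equidistant points on the
  circle, at least \<open>N * a - 1\<close> lie in an interval \<open>[0, a)\<close>, whatever the starting point (lemma
  \<open>card_rotations_hitting_interval\<close>), so the sum of the rotated functions is everywhere at least
  \<open>N * (\<Sum>k<n. a\<^sub>k) - n\<close>. Letting \<open>N\<close> tend to infinity yields \<open>(\<Sum>k<n. a\<^sub>k) \<le> \<rho> S \<le> \<rho> X\<close> (lemma
  \<open>tail_sum_le_risk_measure\<close>). The bound \<open>\<rho> X\<close> is the same for all \<open>n\<close>, and a random variable with
  bounded tail sums is integrable.
\<close>

section \<open>Laws and tail sums\<close>

text \<open>
  For a decreasing sequence of events, the indices of the events containing \<open>\<omega>\<close> form an initial
  segment. Hence the superlevel sets of the counting variable are the events themselves; this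
  determines its distribution function.
\<close>

lemma less_sum_indicator_decseq_iff:
  fixes A :: "nat \<Rightarrow> 'a set" and x :: real
  assumes "decseq A"
  shows "x < (\<Sum>k<n. indicat_real (A k) \<omega>) \<longleftrightarrow> x < 0 \<or> (nat \<lfloor>x\<rfloor> < n \<and> \<omega> \<in> A (nat \<lfloor>x\<rfloor>))"
proof -
  define C where "C = {k. k < n \<and> \<omega> \<in> A k}"
  have sum_eq: "(\<Sum>k<n. indicat_real (A k) \<omega>) = real (card C)"
  proof -
    have "(\<Sum>k<n. indicat_real (A k) \<omega>) = (\<Sum>k\<in>C. 1)"
      by (intro sum.mono_neutral_cong_right) (auto simp: C_def indicator_def)
    then show ?thesis by simp
  qed
  have fin: "finite C" by (simp add: C_def)
  have card_iff: "m < card C \<longleftrightarrow> m < n \<and> \<omega> \<in> A m" for m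
  proof
    assume less: "m < card C"
    show "m < n \<and> \<omega> \<in> A m"
    proof (rule ccontr)
      assume no: "\<not> (m < n \<and> \<omega> \<in> A m)"
      have "C \<subseteq> {..<m}"
      proof
        fix k assume k: "k \<in> C"
        show "k \<in> {..<m}"
        proof (rule ccontr)
          assume "k \<notin> {..<m}"
          then have "m \<le> k" by simp
          then have "A k \<subseteq> A m" using assms by (simp add: decseqD)
          with k \<open>m \<le> k\<close> no show False by (auto simp: C_def)
        qed
      qed
      then have "card C \<le> m" using card_mono[of "{..<m}" C] by simp
      with less show False by simp
    qed
  next
    assume m: "m < n \<and> \<omega> \<in> A m"
    have "{..m} \<subseteq> C"
    proof
      fix k assume "k \<in> {..m}"
      then have "k \<le> m" by simp
      then have "A m \<subseteq> A k" using assms by (simp add: decseqD)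
      with m \<open>k \<le> m\<close> show "k \<in> C" by (auto simp: C_def)
    qed
    then have "card {..m} \<le> card C" using fin by (intro card_mono)
    then show "m < card C" by simp
  qed
  have "x < real (card C) \<longleftrightarrow> x < 0 \<or> nat \<lfloor>x\<rfloor> < card C"
    by linarith
  then show ?thesis unfolding sum_eq card_iff .
qed

lemma (in prob_space) distr_sum_indicator_decseq_eq:
  assumes "decseq A" "decseq B"
    and A [measurable]: "\<And>k. A k \<in> events" and B [measurable]: "\<And>k. B k \<in> events"
    and "\<And>k. prob (A k) = prob (B k)"
  shows "distr M borel (\<lambda>\<omega>. \<Sum>k<n. indicat_real (A k) \<omega>)
       = distr M borel (\<lambda>\<omega>. \<Sum>k<n. indicat_real (B k) \<omega>)"
proof -
  have cdf_eq: "cdf (distr M borel (\<lambda>\<omega>. \<Sum>k<n. indicat_real (E k) \<omega>)) x =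
      (if x < 0 then 0 else if nat \<lfloor>x\<rfloor> < n then 1 - prob (E (nat \<lfloor>x\<rfloor>)) else 1)"
    if "decseq E" and [measurable]: "\<And>k. E k \<in> events" for E x
  proof -
    have "cdf (distr M borel (\<lambda>\<omega>. \<Sum>k<n. indicat_real (E k) \<omega>)) x
        = prob {\<omega> \<in> space M. \<not> x < (\<Sum>k<n. indicat_real (E k) \<omega>)}"
      unfolding cdf_def by (subst measure_distr) (auto intro!: arg_cong[where f = prob])
    also have "{\<omega> \<in> space M. \<not> x < (\<Sum>k<n. indicat_real (E k) \<omega>)}
        = (if x < 0 then {} else if nat \<lfloor>x\<rfloor> < n then space M - E (nat \<lfloor>x\<rfloor>) else space M)"
      unfolding less_sum_indicator_decseq_iff[OF that(1)] by auto
    finally show ?thesis using prob_compl[OF that(2)] prob_space by auto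
  qed
  show ?thesis
  proof (rule cdf_unique)
    show "real_distribution (distr M borel (\<lambda>\<omega>. \<Sum>k<n. indicat_real (A k) \<omega>))"
      by (intro real_distribution_distr) measurable
    show "real_distribution (distr M borel (\<lambda>\<omega>. \<Sum>k<n. indicat_real (B k) \<omega>))"
      by (intro real_distribution_distr) measurable
  qed (simp add: fun_eq_iff cdf_eq assms)
qed

text \<open>
  The tails of \<open>X\<close> at the positive integers are those of the integer part of \<open>X\<close>; they sum to its
  expectation, and \<open>X\<close> exceeds its integer part by at most one.
\<close>

lemma (in prob_space) integrable_if_tail_sums_bounded:
  fixes X :: "'a \<Rightarrow> real"
  assumes [measurable]: "X \<in> borel_measurable M" and nonneg: "\<And>\<omega>. 0 \<le> X \<omega>"
    and bound: "\<And>n. (\<Sum>k<n. prob {\<omega> \<in> space M. real (Suc k) \<le> X \<omega>}) \<le> c"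
  shows "integrable M X"
proof (rule integrableI_nonneg)
  define f where "f \<omega> = nat \<lfloor>X \<omega>\<rfloor>" for \<omega>
  have f_measurable [measurable]: "f \<in> measurable M (count_space UNIV)"
    unfolding f_def by measurable
  have tail: "{\<omega> \<in> space M. t < f \<omega>} = {\<omega> \<in> space M. real (Suc t) \<le> X \<omega>}" for t
    unfolding f_def by (auto; linarith)
  have "(\<integral>\<^sup>+\<omega>. ennreal (X \<omega>) \<partial>M) \<le> (\<integral>\<^sup>+\<omega>. 1 + of_nat (f \<omega>) \<partial>M)"
  proof (rule nn_integral_mono)
    fix \<omega>
    have "X \<omega> \<le> 1 + real (f \<omega>)" unfolding f_def by linarith
    then have "ennreal (X \<omega>) \<le> ennreal (1 + real (f \<omega>))" by (rule ennreal_leI)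
    then show "ennreal (X \<omega>) \<le> 1 + of_nat (f \<omega>)"
      by (simp add: ennreal_of_nat_eq_real_of_nat)
  qed
  also have "\<dots> = 1 + (\<integral>\<^sup>+\<omega>. of_nat (f \<omega>) \<partial>M)"
    by (subst nn_integral_add) (auto simp: emeasure_space_1)
  also have "(\<integral>\<^sup>+\<omega>. of_nat (f \<omega>) \<partial>M) = (\<Sum>t. emeasure M {\<omega> \<in> space M. t < f \<omega>})"
    by (rule nn_integral_nat_function) measurable
  also have "\<dots> \<le> ennreal c"
  proof (rule suminf_le_const)
    fix n
    have "(\<Sum>t<n. emeasure M {\<omega> \<in> space M. t < f \<omega>})
        = ennreal (\<Sum>t<n. prob {\<omega> \<in> space M. real (Suc t) \<le> X \<omega>})"
      unfolding tail emeasure_eq_measure by (rule sum_ennreal) simp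
    also have "\<dots> \<le> ennreal c" by (rule ennreal_leI) (rule bound)
    finally show "(\<Sum>t<n. emeasure M {\<omega> \<in> space M. t < f \<omega>}) \<le> ennreal c" .
  qed simp
  finally have "(\<integral>\<^sup>+\<omega>. ennreal (X \<omega>) \<partial>M) \<le> 1 + ennreal c"
    by (simp add: add_left_mono)
  also have "1 + ennreal c < \<infinity>" by simp
  finally show "(\<integral>\<^sup>+\<omega>. ennreal (X \<omega>) \<partial>M) < \<infinity>" .
qed (use nonneg in auto)

section \<open>Rotations of the circle\<close>

lemma prob_space_unit_interval: "prob_space unit_interval"
  unfolding unit_interval_def by (rule prob_space_restrict_space) auto

lemma space_unit_interval: "space unit_interval = {0..1}"
  by (simp add: unit_interval_def space_restrict_space)

lemma rotated_interval_measurable: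
  "{\<omega> \<in> {0..1}. frac (\<omega> + c) < a} \<in> sets unit_interval"
proof -
  have "{\<omega> \<in> {0..1::real}. frac (\<omega> + c) < a} = {0..1} \<inter> {\<omega> \<in> space borel. \<omega> + c - \<lfloor>\<omega> + c\<rfloor> < a}"
    by (auto simp: frac_def)
  also have "\<dots> \<in> sets borel"
    by (intro sets.Int) measurable
  finally show ?thesis
    unfolding unit_interval_def by (subst sets_restrict_space_iff) auto
qed

text \<open>
  The set is the arc \<open>[0, a)\<close> of the circle, turned back by \<open>c\<close>. Cut open at \<open>0\<close>, it is one interval
  when \<open>a \<le> c\<close> and two intervals otherwise.
\<close>

lemma measure_rotated_interval:
  assumes "0 \<le> a" "a \<le> 1" "0 \<le> c" "c < 1"
  shows "measure unit_interval {\<omega> \<in> {0..1}. frac (\<omega> + c) < a} = a"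
proof -
  have frac_eq: "frac (\<omega> + c) = (if \<omega> + c < 1 then \<omega> + c else \<omega> + c - 1)"
    if "\<omega> \<in> {0..1}" for \<omega>
  proof (cases "\<omega> + c < 1")
    case True
    then show ?thesis using that assms by (simp add: frac_eq)
  next
    case False
    then have "\<lfloor>\<omega> + c\<rfloor> = 1" using that assms by (intro floor_unique) auto
    then show ?thesis using False by (simp add: frac_def)
  qed
  have "measure unit_interval {\<omega> \<in> {0..1}. frac (\<omega> + c) < a}
      = measure lborel {\<omega> \<in> {0..1}. frac (\<omega> + c) < a}"
    unfolding unit_interval_def by (rule measure_restrict_space) auto
  also have "\<dots> = a"
  proof (cases "c < a")
    case True
    have "{\<omega> \<in> {0..1}. frac (\<omega> + c) < a} = {0..<a - c} \<union> {1 - c..1}"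
      using assms True by (auto simp: frac_eq split: if_splits)
    moreover have "measure lborel ({0..<a - c} \<union> {1 - c..1}) = (a - c) + c"
      using assms True by (subst measure_Union) auto
    ultimately show ?thesis by simp
  next
    case False
    have "{\<omega> \<in> {0..1}. frac (\<omega> + c) < a} = {1 - c..<1 - c + a}"
      using assms False by (auto simp: frac_eq split: if_splits)
    then show ?thesis using assms by simp
  qed
  finally show ?thesis .
qed

text \<open>
  The points \<open>x + j / N\<close> visit each of the \<open>N\<close> cells \<open>[i / N, (i + 1) / N)\<close> of the circle
  exactly once, and the cells with \<open>i + 1 \<le> N * a\<close> lie inside \<open>[0, a)\<close>. The function \<open>h\<close> of the proof
  maps the number \<open>i\<close> of a cell to the index \<open>j\<close> of the point in it.
\<close>

lemma card_rotations_hitting_interval: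
  fixes a x :: real and N :: nat
  assumes N: "0 < N" and a: "0 \<le> a" "a \<le> 1"
  shows "real N * a - 1 \<le> real (card {j. j < N \<and> frac (x + real j / real N) < a})"
proof -
  define m where "m = \<lfloor>real N * x\<rfloor>"
  define h where "h i = nat ((int i - m) mod int N)" for i :: nat
  define n where "n = nat \<lfloor>real N * a\<rfloor>"
  have "real N * a \<le> real N * 1" using a by (intro mult_left_mono) auto
  then have n_le: "n \<le> N" unfolding n_def by linarith
  have n_real: "real n \<le> real N * a" unfolding n_def using a by simp
  have inj: "inj_on h {..<n}"
  proof (rule inj_onI)
    fix i i' assume ii: "i \<in> {..<n}" "i' \<in> {..<n}" and "h i = h i'"
    then have "(int i - m) mod int N = (int i' - m) mod int N"
      using N unfolding h_def by (simp add: nat_eq_iff)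
    then have "int i mod int N = int i' mod int N"
      by (metis diff_add_cancel mod_add_left_eq)
    then show "i = i'" using ii n_le by simp
  qed
  have sub: "h ` {..<n} \<subseteq> {j. j < N \<and> frac (x + real j / real N) < a}"
  proof safe
    fix i assume i: "i < n"
    have h_int: "int (h i) = (int i - m) mod int N" using N by (simp add: h_def)
    then show "h i < N" using N
      by (metis of_nat_0_less_iff of_nat_less_iff pos_mod_bound)
    \<comment> \<open>the number of full turns made on the way from \<open>0\<close> to \<open>x + h i / N\<close>\<close>
    define t where "t = - ((int i - m) div int N)"
    have "m + int (h i) = int i + int N * t"
      unfolding h_int t_def using minus_mult_div_eq_mod[of "int i - m" "int N"]
      by (simp add: algebra_simps)
    then have mh: "real_of_int m + real (h i) = real i + real N * of_int t"
      by (metis of_int_add of_int_mult of_int_of_nat_eq)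
    have m: "of_int m \<le> real N * x" "real N * x < of_int m + 1" unfolding m_def by linarith+
    have split: "real N * (x + real (h i) / real N - of_int t) = real N * x + real (h i) - real N * of_int t"
      using N by (simp add: field_simps)
    have low: "real i \<le> real N * (x + real (h i) / real N - of_int t)"
      and up: "real N * (x + real (h i) / real N - of_int t) < real i + 1"
      unfolding split using m mh by linarith+
    have "real i + 1 \<le> real n" using i by simp
    then have less: "real N * (x + real (h i) / real N - of_int t) < real N * a"
      using up n_real by linarith
    then have less_a: "x + real (h i) / real N - of_int t < a" using N by simp
    have ge_0: "0 \<le> x + real (h i) / real N - of_int t"
      using order_trans[OF of_nat_0_le_iff low] N by (simp add: zero_le_mult_iff)
    have "\<lfloor>x + real (h i) / real N\<rfloor> = t"
      using less_a ge_0 a by (intro floor_unique) linarith+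
    then show "frac (x + real (h i) / real N) < a"
      using less_a by (simp add: frac_def)
  qed
  have "real N * a - 1 \<le> real n" unfolding n_def by linarith
  also have "n = card (h ` {..<n})" using inj by (simp add: card_image)
  also have "\<dots> \<le> card {j. j < N \<and> frac (x + real j / real N) < a}"
    using sub by (intro card_mono) auto
  finally show ?thesis by simp
qed

section \<open>Averaging a version independent risk measure\<close>

lemma L0_subspace_sum:
  assumes "L0_subspace M L" "\<And>j. j < N \<Longrightarrow> Y j \<in> L"
  shows "(\<lambda>\<omega>. \<Sum>j<(N::nat). Y j \<omega>) \<in> L"
  using assms(2)
proof (induction N)
  case 0
  then show ?case using assms(1) by (simp add: L0_subspace_def)
next
  case (Suc N)
  then show ?case using assms(1) by (simp add: L0_subspace_def)
qed

lemma risk_measure_const: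
  assumes "L0_subspace M L" "risk_measure M L \<rho>"
  shows "\<rho> (\<lambda>\<omega>. c) = c"
proof -
  have zero: "(\<lambda>\<omega>. 0) \<in> L" using assms(1) by (simp add: L0_subspace_def)
  have hom: "\<And>Y a. Y \<in> L \<Longrightarrow> 0 < a \<Longrightarrow> \<rho> (\<lambda>\<omega>. a * Y \<omega>) = a * \<rho> Y"
    using assms(2) by (simp add: risk_measure_def)
  have "\<rho> (\<lambda>\<omega>. 0) = 2 * \<rho> (\<lambda>\<omega>. 0)" using hom[OF zero, of 2] by simp
  moreover have "\<And>Y c. Y \<in> L \<Longrightarrow> \<rho> (\<lambda>\<omega>. Y \<omega> + c) = \<rho> Y + c"
    using assms(2) by (simp add: risk_measure_def)
  from this[OF zero] have "\<rho> (\<lambda>\<omega>. 0 + c) = \<rho> (\<lambda>\<omega>. 0) + c" .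
  ultimately show ?thesis by simp
qed

text \<open>
  Convexity at the midpoint of \<open>2 * Y\<close> and \<open>2 * Z\<close>; positive homogeneity removes the factors.
\<close>

lemma risk_measure_add_le:
  assumes L: "L0_subspace M L" and \<rho>: "risk_measure M L \<rho>" and Y: "Y \<in> L" and Z: "Z \<in> L"
  shows "\<rho> (\<lambda>\<omega>. Y \<omega> + Z \<omega>) \<le> \<rho> Y + \<rho> Z"
proof -
  have scale: "\<And>a W. W \<in> L \<Longrightarrow> (\<lambda>\<omega>. a * W \<omega>) \<in> L" using L by (simp add: L0_subspace_def)
  have hom: "\<And>W a. W \<in> L \<Longrightarrow> 0 < a \<Longrightarrow> \<rho> (\<lambda>\<omega>. a * W \<omega>) = a * \<rho> W"
    using \<rho> by (simp add: risk_measure_def)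
  have conv: "\<And>V W a. V \<in> L \<Longrightarrow> W \<in> L \<Longrightarrow> 0 \<le> a \<Longrightarrow> a \<le> 1 \<Longrightarrow>
      \<rho> (\<lambda>\<omega>. (1 - a) * V \<omega> + a * W \<omega>) \<le> (1 - a) * \<rho> V + a * \<rho> W"
    using \<rho> by (simp add: risk_measure_def)
  have "\<rho> (\<lambda>\<omega>. (1 - 1/2) * (2 * Y \<omega>) + 1/2 * (2 * Z \<omega>))
      \<le> (1 - 1/2) * \<rho> (\<lambda>\<omega>. 2 * Y \<omega>) + 1/2 * \<rho> (\<lambda>\<omega>. 2 * Z \<omega>)"
    by (intro conv scale Y Z) auto
  then show ?thesis using hom[OF Y, of 2] hom[OF Z, of 2] by simp
qed

lemma risk_measure_sum_le:
  assumes L: "L0_subspace M L" and \<rho>: "risk_measure M L \<rho>"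
    and Y: "\<And>j. j < N \<Longrightarrow> Y j \<in> L"
  shows "\<rho> (\<lambda>\<omega>. \<Sum>j<(N::nat). Y j \<omega>) \<le> (\<Sum>j<N. \<rho> (Y j))"
  using Y
proof (induction N)
  case 0
  then show ?case using risk_measure_const[OF L \<rho>, of 0] by simp
next
  case (Suc N)
  have "\<rho> (\<lambda>\<omega>. (\<Sum>j<N. Y j \<omega>) + Y N \<omega>) \<le> \<rho> (\<lambda>\<omega>. \<Sum>j<N. Y j \<omega>) + \<rho> (Y N)"
    using Suc.prems by (intro risk_measure_add_le[OF L \<rho>] L0_subspace_sum[OF L]) auto
  with Suc show ?case by fastforce
qed

text \<open>
  The left-hand side is the expectation of the variable counting the levels \<open>1, \<dots>, n\<close> reached by \<open>X\<close>,
  a bounded minorant of \<open>X\<close>. The averaging over rotations takes place here.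
\<close>

lemma tail_sum_le_risk_measure:
  assumes L: "L0_subspace unit_interval L" and L1: "L1 unit_interval \<subseteq> L"
    and \<rho>: "risk_measure unit_interval L \<rho>" and law: "version_independent unit_interval L \<rho>"
    and X: "X \<in> L" "\<And>\<omega>. 0 \<le> X \<omega>"
  shows "(\<Sum>k<n. measure unit_interval {\<omega> \<in> space unit_interval. real (Suc k) \<le> X \<omega>}) \<le> \<rho> X"
proof -
  interpret prob_space unit_interval by (rule prob_space_unit_interval)
  have [measurable]: "X \<in> borel_measurable unit_interval"
    using L X(1) by (auto simp: L0_subspace_def)
  define E where "E k = {\<omega> \<in> space unit_interval. real (Suc k) \<le> X \<omega>}" for k
  define a where "a k = prob (E k)" for k
  define S where "S \<omega> = (\<Sum>k<n. indicat_real (E k) \<omega>)" for \<omega>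
  have E [measurable]: "E k \<in> events" for k unfolding E_def by measurable
  have dec_E: "decseq E" by (auto simp: decseq_def E_def)
  have dec_a: "a k' \<le> a k" if "k \<le> k'" for k k'
    unfolding a_def using that dec_E by (intro finite_measure_mono) (auto simp: decseqD)
  have a01: "0 \<le> a k" "a k \<le> 1" for k by (auto simp: a_def)
  have sum_in_L: "(\<lambda>\<omega>. \<Sum>k<n. indicat_real (F k) \<omega>) \<in> L" if [measurable]: "\<And>k. F k \<in> events" for F
    using L1 unfolding L1_def by (auto intro!: integrable_real_indicator simp: less_top[symmetric])
  have S_le: "S \<omega> \<le> X \<omega>" for \<omega>
  proof (rule ccontr)
    assume "\<not> S \<omega> \<le> X \<omega>"
    then have "\<omega> \<in> E (nat \<lfloor>X \<omega>\<rfloor>)"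
      using X(2)[of \<omega>] by (simp add: S_def not_le less_sum_indicator_decseq_iff[OF dec_E])
    then have "real (Suc (nat \<lfloor>X \<omega>\<rfloor>)) \<le> X \<omega>" unfolding E_def by blast
    then show False by linarith
  qed
  have \<rho>_mono: "\<And>Y Z. Y \<in> L \<Longrightarrow> Z \<in> L \<Longrightarrow> (AE \<omega> in unit_interval. Y \<omega> \<le> Z \<omega>) \<Longrightarrow> \<rho> Y \<le> \<rho> Z"
    using \<rho> by (simp add: risk_measure_def)
  have S_L: "S \<in> L" unfolding S_def[abs_def] by (rule sum_in_L) (rule E)
  have \<rho>S: "\<rho> S \<le> \<rho> X" using S_L X(1) S_le by (intro \<rho>_mono) auto
  have bound: "real N * (\<Sum>k<n. a k) - real n \<le> real N * \<rho> X" if N: "0 < N" for N :: nat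
  proof -
    \<comment> \<open>\<open>Q j\<close> is a version of \<open>S\<close>: the events of \<open>S\<close> are replaced by arcs of the same probability.\<close>
    define F where "F j k = {\<omega> \<in> {0..1}. frac (\<omega> + real j / real N) < a k}" for j k
    define Q where "Q j \<omega> = (\<Sum>k<n. indicat_real (F j k) \<omega>)" for j \<omega>
    have F [measurable]: "F j k \<in> events" for j k
      unfolding F_def by (rule rotated_interval_measurable)
    have dec_F: "decseq (F j)" for j
      unfolding decseq_def F_def using dec_a by (blast intro: less_le_trans)
    have Q_L: "Q j \<in> L" for j unfolding Q_def[abs_def] by (rule sum_in_L) (rule F)
    have \<rho>Q: "\<rho> (Q j) = \<rho> S" if "j < N" for j
    proof -
      have "prob (F j k) = prob (E k)" for k
        using measure_rotated_interval[of "a k" "real j / real N"] a01 that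
        by (simp add: F_def a_def)
      then have "distr unit_interval borel (Q j) = distr unit_interval borel S"
        unfolding Q_def[abs_def] S_def[abs_def]
        by (intro distr_sum_indicator_decseq_eq dec_F dec_E F E)
      then show ?thesis using law Q_L S_L unfolding version_independent_def by blast
    qed
    \<comment> \<open>Each of the \<open>n\<close> levels loses at most one against its mean \<open>N * a k\<close>.\<close>
    have sum_Q: "real N * (\<Sum>k<n. a k) - real n \<le> (\<Sum>j<N. Q j \<omega>)" if \<omega>: "\<omega> \<in> space unit_interval" for \<omega>
    proof -
      have "real N * (\<Sum>k<n. a k) - real n = (\<Sum>k<n. real N * a k - 1)"
        by (simp add: sum_subtractf sum_distrib_left)
      also have "\<dots> \<le> (\<Sum>k<n. real (card {j. j < N \<and> frac (\<omega> + real j / real N) < a k}))"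
        using N a01 by (intro sum_mono card_rotations_hitting_interval)
      also have "\<dots> = (\<Sum>k<n. \<Sum>j<N. indicat_real (F j k) \<omega>)"
      proof (rule sum.cong)
        fix k
        have "(\<Sum>j<N. indicat_real (F j k) \<omega>)
            = (\<Sum>j\<in>{j. j < N \<and> frac (\<omega> + real j / real N) < a k}. 1)"
          using \<omega> by (intro sum.mono_neutral_cong_right)
            (auto simp: F_def indicator_def space_unit_interval)
        then show "real (card {j. j < N \<and> frac (\<omega> + real j / real N) < a k})
            = (\<Sum>j<N. indicat_real (F j k) \<omega>)" by simp
      qed simp
      also have "\<dots> = (\<Sum>j<N. Q j \<omega>)" unfolding Q_def by (rule sum.swap)
      finally show ?thesis .
    qed
    have const_L: "(\<lambda>\<omega>. c) \<in> L" for c using L1 by (auto simp: L1_def)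
    have "real N * (\<Sum>k<n. a k) - real n
        = \<rho> (\<lambda>\<omega>. real N * (\<Sum>k<n. a k) - real n)"
      using risk_measure_const[OF L \<rho>] by simp
    also have "\<dots> \<le> \<rho> (\<lambda>\<omega>. \<Sum>j<N. Q j \<omega>)"
      using sum_Q L0_subspace_sum[OF L, of N Q] Q_L const_L by (intro \<rho>_mono AE_I2) auto
    also have "\<dots> \<le> (\<Sum>j<N. \<rho> (Q j))" by (intro risk_measure_sum_le[OF L \<rho>] Q_L)
    also have "\<dots> = real N * \<rho> S" using \<rho>Q by simp
    also have "\<dots> \<le> real N * \<rho> X" using \<rho>S by (intro mult_left_mono) auto
    finally show ?thesis .
  qed
  have "(\<lambda>N. (\<Sum>k<n. a k) - real n / real N) \<longlonglongrightarrow> (\<Sum>k<n. a k) - 0"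
    by (intro tendsto_diff tendsto_const lim_const_over_n)
  then have "(\<Sum>k<n. a k) - 0 \<le> \<rho> X"
  proof (rule LIMSEQ_le_const2)
    show "\<exists>N0. \<forall>N\<ge>N0. (\<Sum>k<n. a k) - real n / real N \<le> \<rho> X"
    proof (intro exI[of _ 1] allI impI)
      fix N :: nat assume "1 \<le> N"
      then show "(\<Sum>k<n. a k) - real n / real N \<le> \<rho> X"
        using bound[of N] by (simp add: field_simps)
    qed
  qed
  then show ?thesis by (simp add: a_def E_def)
qed

theorem theorem19:
  fixes L :: "(real \<Rightarrow> real) set"
  assumes "L0_subspace unit_interval L"
    and "L1 unit_interval \<subset> L"
    and "\<And>Y. Y \<in> L \<Longrightarrow> (\<lambda>\<omega>. \<bar>Y \<omega>\<bar>) \<in> L"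
  shows "\<not> (\<exists>\<rho>. risk_measure unit_interval L \<rho> \<and> version_independent unit_interval L \<rho>)"
proof
  assume "\<exists>\<rho>. risk_measure unit_interval L \<rho> \<and> version_independent unit_interval L \<rho>"
  then obtain \<rho> where \<rho>: "risk_measure unit_interval L \<rho>" "version_independent unit_interval L \<rho>"
    by blast
  interpret prob_space unit_interval by (rule prob_space_unit_interval)
  obtain Y where Y: "Y \<in> L" "\<not> integrable unit_interval Y"
    using assms(2) by (auto simp: L1_def)
  have measurable_Y: "Y \<in> borel_measurable unit_interval"
    using assms(1) Y(1) by (auto simp: L0_subspace_def)
  have "integrable unit_interval (\<lambda>\<omega>. \<bar>Y \<omega>\<bar>)"
  proof (rule integrable_if_tail_sums_bounded)
    show "(\<lambda>\<omega>. \<bar>Y \<omega>\<bar>) \<in> borel_measurable unit_interval" using measurable_Y by measurable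
    show "(\<Sum>k<n. prob {\<omega> \<in> space unit_interval. real (Suc k) \<le> \<bar>Y \<omega>\<bar>})
        \<le> \<rho> (\<lambda>\<omega>. \<bar>Y \<omega>\<bar>)" for n
      using assms(1,2) \<rho> assms(3)[OF Y(1)] by (intro tail_sum_le_risk_measure) auto
  qed simp
  with Y(2) measurable_Y show False by (simp add: integrable_abs_iff)
qed

end
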